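(* Let $n=3$ and let $k_0=\max\{k\in\mathbb{N}_0 : \tfrac{k(k+1)}{2}<n-1\}$ (so $k_0=1$). Let $r(z,\bar z)=\sum_{a,b}c_{ab}z^a\bar z^b$ be a real polynomial on the diagonal of $\mathbb{C}^3\times\mathbb{C}^3$ whose coefficient matrix $(c_{ab})$ is diagonal, and suppose that there is a holomorphic polynomial mapping $h$ on $\mathbb{C}^3$ such that $r(z,\bar z)\,\lVert z\rVert^2=\lVert h(z)\rVert^2$. Let $\rho$ be the rank of $\lVert h\rVert^2$. Then either $$\rho\ \ge\ (k_0+1)n-\frac{k_0(k_0+1)}{2}\ =\ 5,$$ or there exists an integer $k$ with $0\le k\le k_0$ such that $$nk-\frac{k(k-1)}{2}\ \le\ \rho\ \le\ nk .$$
   Context: Here $z=(z_1,z_2,z_3)$, $\lVert z\rVert^2=\sum_{j}|z_j|^2$, and for a holomorphic polynomial mapping $h=(h_1,\dots,h_m):\mathbb{C}^3\to\mathbb{C}^m$, $\lVert h(z)\rVert^2=\sum_{j=1}^m|h_j(z)|^2$. A real polynomial on the diagonal of $\mathbb{C}^n\times\mathbb{C}^n$ is a real-valued polynomial $r(z,\bar z)=\sum_{a,b}c_{ab}z^a\bar z^b$ (finite sum over multi-indices $a,b\in\mathbb{N}_0^n$), so $(c_{ab})$ is a Hermitian matrix, called the coefficient matrix of $r$. The coefficient matrix is diagonal if $c_{ab}=0$ whenever $a\ne b$. The rank of a real polynomial is the rank of its coefficient matrix. *)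

theory Defs
  imports "HOL-Analysis.Analysis" "HOL-Computational_Algebra.Polynomial"
    "HOL-Library.Poly_Mapping" "HOL-Library.Function_Algebras"
begin

text \<open>Multi-indices in \<open>\<nat>\<^sub>0\<^sup>n\<close> are vectors of type \<open>nat ^ 'n\<close>, where \<open>n = CARD('n)\<close>.\<close>

definition monom_at :: "complex ^ 'n \<Rightarrow> nat ^ 'n \<Rightarrow> complex" where
  "monom_at z a = (\<Prod>i\<in>UNIV. (z $ i) ^ (a $ i))"

definition holomorphic_polynomial :: "(complex ^ 'n \<Rightarrow> complex) \<Rightarrow> bool" where
  "holomorphic_polynomial f \<longleftrightarrow>
     (\<exists>p :: (nat ^ 'n) \<Rightarrow>\<^sub>0 complex. 
        \<forall>z. f z = (\<Sum>a\<in>Poly_Mapping.keys p. Poly_Mapping.lookup p a * monom_at z a))"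

definition holomorphic_polynomial_mapping :: "(complex ^ 'n \<Rightarrow> complex ^ 'm) \<Rightarrow> bool" where
  "holomorphic_polynomial_mapping h \<longleftrightarrow> (\<forall>j. holomorphic_polynomial (\<lambda>z. h z $ j))"

text \<open>A matrix \<open>c\<close> indexed by pairs of multi-indices, with only finitely many nonzero entries,
  gives the polynomial \<open>\<Sum>\<^bsub>a,b\<^esub> c\<^bsub>ab\<^esub> z\<^sup>a w\<^sup>b\<close>; the diagonal is \<open>w = cnj z\<close>.\<close>

definition diag_eval :: "(((nat ^ 'n) \<times> (nat ^ 'n)) \<Rightarrow>\<^sub>0 complex) \<Rightarrow> complex ^ 'n \<Rightarrow> complex" where
  "diag_eval c z =
     (\<Sum>(a, b)\<in>Poly_Mapping.keys c.
        Poly_Mapping.lookup c (a, b) * monom_at z a * cnj (monom_at z b))"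

definition real_polynomial :: "(complex ^ 'n \<Rightarrow> real) \<Rightarrow> bool" where
  "real_polynomial r \<longleftrightarrow> (\<exists>c. \<forall>z. complex_of_real (r z) = diag_eval c z)"

text \<open>For a real polynomial the matrix is unique, see \<open>coeff_matrix_eqI\<close> below.\<close>

definition coeff_matrix :: "(complex ^ 'n \<Rightarrow> real) \<Rightarrow> (((nat ^ 'n) \<times> (nat ^ 'n)) \<Rightarrow>\<^sub>0 complex)" where
  "coeff_matrix r = (THE c. \<forall>z. complex_of_real (r z) = diag_eval c z)"

definition matrix_is_diagonal :: "(('a \<times> 'a) \<Rightarrow>\<^sub>0 complex) \<Rightarrow> bool" where
  "matrix_is_diagonal c \<longleftrightarrow> (\<forall>a b. a \<noteq> b \<longrightarrow> Poly_Mapping.lookup c (a, b) = 0)"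

text \<open>The rank is the complex dimension of the span of the rows; all but finitely many rows
  vanish.\<close>

definition matrix_rank :: "(('a \<times> 'a) \<Rightarrow>\<^sub>0 complex) \<Rightarrow> nat" where
  "matrix_rank c =
     vector_space.dim (\<lambda>(s :: complex) (f :: 'a \<Rightarrow> complex) x. s * f x)
       (range (\<lambda>a b. Poly_Mapping.lookup c (a, b)))"

lemma vector_space_complex_fun:
  "vector_space (\<lambda>(s :: complex) (f :: 'a \<Rightarrow> complex) x. s * f x)"
  by unfold_locales (auto simp: plus_fun_def algebra_simps)

definition real_polynomial_rank :: "(complex ^ 'n \<Rightarrow> real) \<Rightarrow> nat" where
  "real_polynomial_rank r = matrix_rank (coeff_matrix r)"

lemma poly_coeffs_eq_0:
  fixes f :: "'i \<Rightarrow> complex"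
  assumes "finite I" "inj_on e I" "infinite T"
    and zero: "\<And>t. t \<in> T \<Longrightarrow> (\<Sum>i\<in>I. f i * t ^ e i) = 0" and "i \<in> I"
  shows "f i = 0"
proof -
  define p where "p = (\<Sum>i\<in>I. monom (f i) (e i))"
  have "poly p t = (\<Sum>i\<in>I. f i * t ^ e i)" for t
    by (simp add: p_def poly_sum poly_monom)
  then have "T \<subseteq> {t. poly p t = 0}"
    using zero by auto
  with \<open>infinite T\<close> have "p = 0"
    using poly_roots_finite finite_subset by blast
  have "coeff p (e i) = (\<Sum>j\<in>I. if j = i then f j else 0)"
    using \<open>inj_on e I\<close> \<open>i \<in> I\<close>
    by (auto simp: p_def coeff_sum inj_on_def intro!: sum.cong)
  also have "\<dots> = f i"
    using \<open>finite I\<close> \<open>i \<in> I\<close> by simp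
  finally show ?thesis
    using \<open>p = 0\<close> by simp
qed

lemma infinite_unit_circle: "infinite {u :: complex. norm u = 1}"
proof -
  have "inj_on cis {0..1}"
  proof (rule inj_onI)
    fix x y :: real
    assume xy: "x \<in> {0..1}" "y \<in> {0..1}" "cis x = cis y"
    then have "cos x = cos y" by (metis cis.sel(1))
    moreover have "1 \<le> pi" using pi_gt3 by linarith
    ultimately show "x = y" using xy by (auto intro: cos_inj_pi)
  qed
  then have "infinite (cis ` {0..1})"
    by (simp add: finite_image_iff infinite_Icc)
  then show ?thesis
    by (rule contrapos_nn) (auto elim!: finite_subset[rotated])
qed

lemma univariate_diag_coeffs_eq_0:
  fixes k :: "'i \<Rightarrow> complex"
  assumes "finite S" and inj: "inj_on (\<lambda>s. (p s, q s)) S"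
    and zero: "\<And>x. (\<Sum>s\<in>S. k s * x ^ p s * cnj x ^ q s) = 0" and "s \<in> S"
  shows "k s = 0"
proof -
  define F where "F m = {s \<in> S. p s + q s = m}" for m
  have fin: "finite (F m)" for m
    using \<open>finite S\<close> by (simp add: F_def)
  have homogeneous: "(\<Sum>s\<in>F m. k s * u ^ p s * cnj u ^ q s) = 0" for u m
  proof (cases "m \<in> (\<lambda>s. p s + q s) ` S")
    case True
    show ?thesis
    proof (rule poly_coeffs_eq_0[where I = "(\<lambda>s. p s + q s) ` S" and e = id
          and T = "range complex_of_real" and i = m])
      show "infinite (range complex_of_real)"
        by (simp add: finite_image_iff inj_on_def infinite_UNIV_char_0)
      fix t assume "t \<in> range complex_of_real"
      then obtain x where t: "t = complex_of_real x" by auto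
      have "(\<Sum>m\<in>(\<lambda>s. p s + q s) ` S. (\<Sum>s\<in>F m. k s * u ^ p s * cnj u ^ q s) * t ^ id m)
          = (\<Sum>m\<in>(\<lambda>s. p s + q s) ` S. \<Sum>s\<in>F m. k s * (t * u) ^ p s * cnj (t * u) ^ q s)"
        unfolding sum_distrib_right
        by (intro sum.cong refl) (auto simp: t F_def power_add power_mult_distrib)
      also have "\<dots> = (\<Sum>s\<in>S. k s * (t * u) ^ p s * cnj (t * u) ^ q s)"
        unfolding F_def by (rule sum.image_gen[symmetric]) fact
      finally show "(\<Sum>m\<in>(\<lambda>s. p s + q s) ` S. (\<Sum>s\<in>F m. k s * u ^ p s * cnj u ^ q s) * t ^ id m) = 0"
        by (simp only: zero)
    qed (use True \<open>finite S\<close> in auto)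
  next
    case False
    then have "F m = {}" by (auto simp: F_def)
    then show ?thesis by simp
  qed
  define m where "m = p s + q s"
  show ?thesis
  proof (rule poly_coeffs_eq_0[where I = "F m" and e = "\<lambda>s. 2 * p s" and i = s])
    show "inj_on (\<lambda>s. 2 * p s) (F m)"
      using inj by (auto simp: F_def inj_on_def)
    show "infinite {u :: complex. norm u = 1}" by (rule infinite_unit_circle)
    fix u :: complex assume "u \<in> {u. norm u = 1}"
    then have u: "u * cnj u = 1"
      by (simp add: complex_norm_square[symmetric])
    have "k s * u ^ (2 * p s) = u ^ m * (k s * u ^ p s * cnj u ^ q s)" if "s \<in> F m" for s
    proof -
      have "u ^ m * (k s * u ^ p s * cnj u ^ q s) = k s * u ^ (2 * p s) * (u * cnj u) ^ q s"
        using that by (auto simp: F_def power_add power_mult_distrib mult_2)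
      then show ?thesis by (simp only: u power_one mult_1_right)
    qed
    then have "(\<Sum>s\<in>F m. k s * u ^ (2 * p s)) = u ^ m * (\<Sum>s\<in>F m. k s * u ^ p s * cnj u ^ q s)"
      unfolding sum_distrib_left by (intro sum.cong refl)
    then show "(\<Sum>s\<in>F m. k s * u ^ (2 * p s)) = 0"
      by (simp add: homogeneous)
  qed (use fin \<open>s \<in> S\<close> in \<open>auto simp: F_def m_def\<close>)
qed

lemma digits_less:
  fixes f :: "nat \<Rightarrow> nat"
  assumes "\<And>i. i < N \<Longrightarrow> f i < B"
  shows "(\<Sum>i<N. f i * B ^ i) < B ^ N"
  using assms
proof (induction N)
  case (Suc N)
  then have "(\<Sum>i<N. f i * B ^ i) < B ^ N" "Suc (f N) \<le> B"
    by (simp_all add: Suc_leI)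
  moreover from this have "Suc (f N) * B ^ N \<le> B * B ^ N"
    by (intro mult_right_mono) auto
  ultimately show ?case by simp
qed simp

lemma digits_inj:
  fixes f g :: "nat \<Rightarrow> nat"
  assumes "\<And>i. i < N \<Longrightarrow> f i < B" "\<And>i. i < N \<Longrightarrow> g i < B"
    and "(\<Sum>i<N. f i * B ^ i) = (\<Sum>i<N. g i * B ^ i)" and "j < N"
  shows "f j = g j"
  using assms
proof (induction N)
  case (Suc N)
  let ?s = "\<lambda>f :: nat \<Rightarrow> nat. \<Sum>i<N. f i * B ^ i"
  have less: "?s f < B ^ N" "?s g < B ^ N"
    by (rule digits_less; use Suc.prems in simp)+
  have eq: "?s f + f N * B ^ N = ?s g + g N * B ^ N"
    using Suc.prems(3) by simp
  have "(?s f + f N * B ^ N) mod B ^ N = ?s f" "(?s g + g N * B ^ N) mod B ^ N = ?s g"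
    using less by simp_all
  then have sums: "?s f = ?s g" using eq by simp
  moreover have "B \<noteq> 0" using Suc.prems(1) by fastforce
  ultimately have "f N = g N" using eq by simp
  moreover have "f j = g j" if "j < N"
    using Suc.IH Suc.prems sums that by simp
  ultimately show ?case
    using \<open>j < Suc N\<close> less_Suc_eq by auto
qed simp

lemma diag_eval_eq_sum:
  assumes "finite S" "Poly_Mapping.keys c \<subseteq> S"
  shows "diag_eval c z =
     (\<Sum>(a, b)\<in>S. Poly_Mapping.lookup c (a, b) * monom_at z a * cnj (monom_at z b))"
  unfolding diag_eval_def using assms
  by (intro sum.mono_neutral_left) (auto simp: in_keys_iff)

lemma diag_eval_inj:
  fixes c d :: "(((nat ^ 'n) \<times> (nat ^ 'n)) \<Rightarrow>\<^sub>0 complex)"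
  assumes eq: "\<And>z. diag_eval c z = diag_eval d z"
  shows "c = d"
proof -
  define S where "S = Poly_Mapping.keys c \<union> Poly_Mapping.keys d"
  have fin: "finite S" by (simp add: S_def)
  obtain e0 :: "'n \<Rightarrow> nat" and N where e0: "bij_betw e0 UNIV {..<N}"
    using ex_bij_betw_finite_nat[OF finite[of "UNIV :: 'n set"]]
    by (metis atLeast0LessThan)
  define A where "A = fst ` S \<union> snd ` S"
  have finA: "finite A" using fin by (simp add: A_def)
  define B where "B = Suc (\<Sum>a\<in>A. \<Sum>i\<in>UNIV. a $ i)"
  have B: "a $ i < B" if "a \<in> A" for a i
  proof -
    have "a $ i \<le> (\<Sum>i\<in>UNIV. a $ i)" by (rule member_le_sum) auto
    also have "\<dots> \<le> (\<Sum>a\<in>A. \<Sum>i\<in>UNIV. a $ i)"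
      using that finA by (intro member_le_sum[where f = "\<lambda>a. \<Sum>i\<in>UNIV. a $ i"]) auto
    finally show ?thesis by (simp add: B_def)
  qed
  define \<phi> where "\<phi> a = (\<Sum>i\<in>UNIV. a $ i * B ^ e0 i)" for a :: "nat ^ 'n"
  have \<phi>: "\<phi> a = (\<Sum>m<N. a $ (inv e0 m) * B ^ m)" for a
    unfolding \<phi>_def using e0
    by (subst sum.reindex_bij_betw[OF e0, symmetric])
       (auto simp: bij_betw_def intro!: sum.cong)
  have inj: "a = b" if "a \<in> A" "b \<in> A" "\<phi> a = \<phi> b" for a b
  proof -
    have "a $ i = b $ i" for i
    proof -
      have "e0 i < N" using e0 by (auto simp: bij_betw_def)
      then have "a $ (inv e0 (e0 i)) = b $ (inv e0 (e0 i))"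
        using that B digits_inj[of N "\<lambda>m. a $ (inv e0 m)" B "\<lambda>m. b $ (inv e0 m)" "e0 i"]
        by (simp add: \<phi>)
      then show ?thesis using e0 by (simp add: bij_betw_def)
    qed
    then show ?thesis by (simp add: vec_eq_iff)
  qed
  have monom: "monom_at (\<chi> i. x ^ (B ^ e0 i)) a = x ^ \<phi> a" for x a
    by (simp add: monom_at_def \<phi>_def power_sum mult.commute flip: power_mult)
  have zero: "(\<Sum>s\<in>S. (Poly_Mapping.lookup c s - Poly_Mapping.lookup d s) *
       x ^ \<phi> (fst s) * cnj x ^ \<phi> (snd s)) = 0" for x
    using eq[of "\<chi> i. x ^ (B ^ e0 i)"]
    by (simp add: diag_eval_eq_sum[OF fin] S_def monom case_prod_unfold left_diff_distrib
        sum_subtractf)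
  have "Poly_Mapping.lookup c s - Poly_Mapping.lookup d s = 0" if "s \<in> S" for s
  proof (rule univariate_diag_coeffs_eq_0[OF fin _ zero that])
    show "inj_on (\<lambda>s. (\<phi> (fst s), \<phi> (snd s))) S"
    proof -
      have "fst s \<in> A" "snd s \<in> A" if "s \<in> S" for s
        using that by (simp_all add: A_def)
      then show ?thesis
        by (intro inj_onI) (auto simp: prod_eq_iff intro!: inj)
    qed
  qed
  moreover have "Poly_Mapping.lookup c s - Poly_Mapping.lookup d s = 0" if "s \<notin> S" for s
    using that by (simp add: S_def in_keys_iff)
  ultimately show ?thesis
    by (intro poly_mapping_eqI) (metis eq_iff_diff_eq_0)
qed

lemma coeff_matrix_eqI:
  assumes "\<And>z. complex_of_real (r z) = diag_eval c z"
  shows "coeff_matrix r = c"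
  unfolding coeff_matrix_def using assms by (intro the_equality) (auto intro!: diag_eval_inj)

end

theory Submission
  imports Defs
begin

text \<open>The rank is a number of terms. Comparing coefficient matrices in \<open>r z * (norm z)\<^sup>2 =
  (norm (h z))\<^sup>2\<close> shows that the matrix of the right-hand side is diagonal, because that of
  \<open>r\<close> is, and that its diagonal entries are nonnegative, because it is a Gram matrix. Hence the
  rank is the number of nonzero diagonal entries. Replacing \<open>\<bar>z\<^sub>i\<bar>\<^sup>2\<close> by
  independent variables gives a real polynomial \<open>F\<close> in \<open>x\<close>, \<open>y\<close>,
  \<open>z\<close> with these entries as coefficients, and \<open>F\<close> is divisible by \<open>x + y +
  z\<close>. The theorem therefore says that a polynomial with positive coefficients that vanishes on the
  plane \<open>x + y + z = 0\<close> has \<open>0\<close>, \<open>3\<close> or at least \<open>5\<close>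
  terms (\<open>plane_relation_term_count\<close>).

  It is enough to treat homogeneous \<open>F \<noteq> 0\<close>. Among the exponents of \<open>F\<close>,
  those that minimize the exponent of one variable form a side of a triangle. Near a point of the plane
  where that variable vanishes, the terms of the side dominate, so they cancel among themselves
  (\<open>face_relation\<close>). Hence every side carries at least two terms; if it carries exactly two,
  then these have equal coefficients and their exponents on the side differ by an odd number
  (\<open>face_pair\<close>). Two sides share at most one term, their common corner, so there are at least
  three terms.

  Suppose that there are exactly four. Either some corner is missing, and the four terms are distributed
  over the sides in essentially one way (\<open>no_four_terms_disjoint_faces\<close>), or the terms are
  three corners of a triangle and one more (\<open>no_four_terms_triangle\<close>). In both cases the
  coefficients at the ends of the two-term sides agree, and evaluating \<open>F\<close> at \<open>(1, 1, -
  2)\<close>, in the second case also at its permutations, gives a contradiction.\<close>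

section \<open>Positive polynomials vanishing on the plane \<open>x + y + z = 0\<close>\<close>

text \<open>Terms are indexed by an abstract set, with their three exponents given by the functions
  \<open>i\<close>, \<open>j\<close>, \<open>k\<close>; the joint injectivity says that different terms
  belong to different monomials. The roles of the three variables can then be permuted by permuting these
  functions.\<close>

definition plane_relation ::
    "'b set \<Rightarrow> ('b \<Rightarrow> real) \<Rightarrow> ('b \<Rightarrow> nat) \<Rightarrow> ('b \<Rightarrow> nat) \<Rightarrow> ('b \<Rightarrow> nat) \<Rightarrow> bool" where
  "plane_relation S d i j k \<longleftrightarrow>
     finite S \<and> (\<forall>b\<in>S. d b > 0) \<and>
     (\<forall>b\<in>S. \<forall>c\<in>S. i b = i c \<and> j b = j c \<and> k b = k c \<longrightarrow> b = c) \<and>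
     (\<forall>x y z. x + y + z = 0 \<longrightarrow> (\<Sum>b\<in>S. d b * x ^ i b * y ^ j b * z ^ k b) = 0)"

lemma plane_relationD:
  "plane_relation S d i j k \<Longrightarrow> x + y + z = 0 \<Longrightarrow> (\<Sum>b\<in>S. d b * x ^ i b * y ^ j b * z ^ k b) = 0"
  by (simp add: plane_relation_def)

lemma plane_relation_swap:
  assumes "plane_relation S d i j k" shows "plane_relation S d j i k"
  unfolding plane_relation_def
proof (intro conjI allI impI)
  fix x y z :: real assume "x + y + z = 0"
  then have "(\<Sum>b\<in>S. d b * y ^ i b * x ^ j b * z ^ k b) = 0"
    by (intro plane_relationD[OF assms]) simp
  then show "(\<Sum>b\<in>S. d b * x ^ j b * y ^ i b * z ^ k b) = 0"
    by (simp add: mult_ac)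
qed (use assms in \<open>auto simp: plane_relation_def\<close>)

lemma plane_relation_rotate:
  assumes "plane_relation S d i j k" shows "plane_relation S d j k i"
  unfolding plane_relation_def
proof (intro conjI allI impI)
  fix x y z :: real assume "x + y + z = 0"
  then have "(\<Sum>b\<in>S. d b * z ^ i b * x ^ j b * y ^ k b) = 0"
    by (intro plane_relationD[OF assms]) simp
  then show "(\<Sum>b\<in>S. d b * x ^ j b * y ^ k b * z ^ i b) = 0"
    by (simp add: mult_ac)
qed (use assms in \<open>auto simp: plane_relation_def\<close>)

text \<open>The plane is invariant under scaling by \<open>t\<close>, which multiplies a term of degree
  \<open>m\<close> by \<open>t\<^sup>m\<close>. So the relation, read as a polynomial in \<open>t\<close>,
  has vanishing coefficients.\<close>

lemma plane_relation_homogeneous_part: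
  assumes "plane_relation S d i j k"
  shows "plane_relation {b \<in> S. i b + j b + k b = m} d i j k"
proof -
  have fin: "finite S" using assms by (simp add: plane_relation_def)
  have "(\<Sum>b | b \<in> S \<and> i b + j b + k b = m. d b * x ^ i b * y ^ j b * z ^ k b) = 0"
    if "x + y + z = 0" for x y z
  proof -
    define p where "p = (\<Sum>b\<in>S. monom (d b * x ^ i b * y ^ j b * z ^ k b) (i b + j b + k b))"
    have "poly p t = 0" for t
    proof -
      have "t * x + t * y + t * z = 0"
        using that by (simp flip: distrib_left)
      then have "(\<Sum>b\<in>S. d b * (t * x) ^ i b * (t * y) ^ j b * (t * z) ^ k b) = 0"
        using assms by (simp add: plane_relation_def)
      then show ?thesis
        by (simp add: p_def poly_sum poly_monom power_mult_distrib power_add mult_ac)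
    qed
    then have "p = 0" using poly_all_0_iff_0 by blast
    then have "coeff p m = 0" by simp
    then show ?thesis
      by (simp add: p_def coeff_sum sum.inter_filter[OF fin] flip: coeff_monom)
  qed
  then show ?thesis using assms by (simp add: plane_relation_def)
qed

text \<open>For a homogeneous set of exponents these are the points on one side of the smallest triangle,
  with sides parallel to those of the standard simplex, that contains the Newton polygon.\<close>

definition face :: "('b \<Rightarrow> nat) \<Rightarrow> 'b set \<Rightarrow> 'b set" where
  "face k S = {b \<in> S. \<forall>c\<in>S. k b \<le> k c}"

text \<open>On the line \<open>(1, - 1 - t, t)\<close> of the plane, divide the relation by the lowest power
  of \<open>t\<close> that occurs and let \<open>t\<close> tend to \<open>0\<close>: only the terms of the
  face survive.\<close>

lemma face_relation:
  assumes "plane_relation S d i j k"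
  shows "(\<Sum>b\<in>face k S. d b * (-1) ^ j b) = 0"
proof (cases "S = {}")
  case False
  have fin: "finite S" using assms by (simp add: plane_relation_def)
  then obtain b0 where b0: "b0 \<in> S" "\<And>c. c \<in> S \<Longrightarrow> k b0 \<le> k c"
    using False by (metis arg_min_if_finite(1) arg_min_least)
  have face: "face k S = {b \<in> S. k b = k b0}"
    using b0 by (auto simp: face_def intro: antisym)
  \<comment> \<open>the quotient of the relation by \<open>t ^ k b0\<close>; evaluating it at \<open>0\<close> replaces the limit\<close>
  define p where "p = (\<Sum>b\<in>S. smult (d b) ([:-1, -1:] ^ j b * monom 1 (k b - k b0)))"
  have "poly (monom 1 (k b0) * p) t = 0" for t
  proof -
    have "(\<Sum>b\<in>S. d b * 1 ^ i b * (- 1 - t) ^ j b * t ^ k b) = 0"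
      by (rule plane_relationD[OF assms]) simp
    moreover have "t ^ k b = t ^ k b0 * t ^ (k b - k b0)" if "b \<in> S" for b
      using b0(2)[OF that] by (simp flip: power_add)
    ultimately show ?thesis
      by (simp add: p_def poly_sum poly_monom sum_distrib_left mult_ac cong: sum.cong)
  qed
  then have "monom 1 (k b0) * p = 0" using poly_all_0_iff_0 by blast
  then have "poly p 0 = 0" by simp
  moreover have "poly p 0 = (\<Sum>b\<in>S. if k b = k b0 then d b * (-1) ^ j b else 0)"
    unfolding p_def poly_sum
    using b0(2) by (intro sum.cong) (fastforce simp: poly_monom power_0_left)+
  ultimately show ?thesis
    by (simp add: face sum.inter_filter[OF fin])
qed (simp add: face_def)

text \<open>Two positive coefficients with signs \<open>(-1) ^ j b\<close> cancel only if they are equal and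
  the signs differ; up to a common factor, the two terms form a multiple of \<open>x\<^sup>m +
  y\<^sup>m\<close> with \<open>m\<close> odd.\<close>

lemma face_pair:
  assumes "plane_relation S d i j k" "face k S = {A, B}" "A \<noteq> B"
  shows "d A = d B \<and> (even (j A) \<longleftrightarrow> odd (j B))"
proof -
  have "d A > 0" "d B > 0"
    using assms unfolding plane_relation_def face_def by blast+
  moreover have "d A * (-1) ^ j A + d B * (-1) ^ j B = 0"
    using face_relation[OF assms(1)] assms(2,3) by simp
  ultimately show ?thesis
    by (cases "even (j A)"; cases "even (j B)") auto
qed

text \<open>A single term cannot cancel in \<open>face_relation\<close>.\<close>

lemma card_face:
  assumes rel: "plane_relation S d i j k" and "S \<noteq> {}"
  shows "card (face k S) \<ge> 2"
proof (rule ccontr)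
  assume *: "\<not> ?thesis"
  have fin: "finite S" using assms by (simp add: plane_relation_def)
  then obtain b0 where "b0 \<in> S" "\<And>c. c \<in> S \<Longrightarrow> k b0 \<le> k c"
    using assms(2) by (metis arg_min_if_finite(1) arg_min_least)
  then have "b0 \<in> face k S" by (auto simp: face_def)
  moreover have "finite (face k S)" using fin by (simp add: face_def)
  ultimately have "card (face k S) = 1"
    using * by (metis One_nat_def Suc_1 Suc_leI card_gt_0_iff empty_iff less_one linorder_neqE_nat not_le)
  with \<open>b0 \<in> face k S\<close> have f: "face k S = {b0}"
    by (metis card_1_singletonE singletonD)
  have "d b0 > 0" using rel \<open>b0 \<in> S\<close> by (simp add: plane_relation_def)
  with face_relation[OF rel] show False by (simp add: f)
qed

text \<open>In a fixed degree, two minimal exponents determine the third one. So two sides meet in at most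
  one term, the corner of the triangle in which the third exponent is largest.\<close>

lemma faces_meet_once:
  assumes "plane_relation S d i j k" and "\<And>b. b \<in> S \<Longrightarrow> i b + j b + k b = m"
    and "b \<in> face i S" "b \<in> face j S" "c \<in> face i S" "c \<in> face j S"
  shows "b = c"
proof -
  have S: "b \<in> S" "c \<in> S" using assms(3,5) by (auto simp: face_def)
  have "i b = i c" "j b = j c"
    using assms(3-6) by (auto simp: face_def intro: antisym)
  moreover from this have "k b = k c"
    using assms(2)[OF S(1)] assms(2)[OF S(2)] by simp
  ultimately show ?thesis
    using assms(1) S by (auto simp: plane_relation_def)
qed

lemma card_faces_Int:
  assumes "plane_relation S d i j k" and "\<And>b. b \<in> S \<Longrightarrow> i b + j b + k b = m"
  shows "card (face i S \<inter> face j S) \<le> 1"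
  using faces_meet_once[OF assms] by (intro card_le_Suc0_iff_eq[THEN iffD2, folded One_nat_def] ballI)
    (use assms(1) in \<open>auto simp: face_def plane_relation_def\<close>)

text \<open>At \<open>(1, 1, - 2)\<close> the sign of a term depends only on the parity of its third
  exponent, and a large third exponent outweighs the terms with a small one. Both effects restrict which
  exponents can occur.\<close>

lemma relation_at_1_1_minus_2:
  assumes "plane_relation S d i j k" "\<And>b. b \<in> S \<Longrightarrow> k0 \<le> k b"
  shows "(\<Sum>b\<in>S. d b * (-2) ^ (k b - k0)) = 0"
proof -
  have "(-2) ^ k0 * (\<Sum>b\<in>S. d b * (-2) ^ (k b - k0)) = (\<Sum>b\<in>S. d b * 1 ^ i b * 1 ^ j b * (-2) ^ k b)"
    using assms(2) by (auto simp: sum_distrib_left mult.left_commute simp flip: power_add intro!: sum.cong)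
  also have "\<dots> = 0" by (rule plane_relationD[OF assms(1)]) simp
  finally show ?thesis by simp
qed

text \<open>If the corner between two sides is missing, these sides alone use up all four terms, two on
  each. The third side must then join one term \<open>A\<close>, \<open>B\<close> from each of them, so that
  all three sides are pairs. Hence all four coefficients agree, and at \<open>(1, 1, - 2)\<close> the
  relation becomes, up to a factor, \<open>1 + 1 - 2\<^sup>p - 2\<^sup>q = 0\<close> with odd
  \<open>p\<close> and \<open>q\<close>, which is impossible.\<close>

lemma no_four_terms_disjoint_faces:
  assumes rel: "plane_relation S d i j k" and hom: "\<And>b. b \<in> S \<Longrightarrow> i b + j b + k b = m"
    and four: "card S = 4" and disj: "face i S \<inter> face j S = {}"
  shows False
proof -
  note rel' = plane_relation_rotate[OF rel] plane_relation_rotate[OF plane_relation_rotate[OF rel]]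
  have fin: "finite S" and "S \<noteq> {}" using four by (auto intro: card_ge_0_finite)
  have sub: "face i S \<subseteq> S" "face j S \<subseteq> S" "face k S \<subseteq> S"
    by (auto simp: face_def)
  note finf = sub[THEN finite_subset, OF fin]
  have ge: "card (face i S) \<ge> 2" "card (face j S) \<ge> 2" "card (face k S) \<ge> 2"
    using card_face \<open>S \<noteq> {}\<close> rel rel' by metis+
  have "card (face i S) + card (face j S) = card (face i S \<union> face j S)"
    using card_Un_disjoint[OF finf(1,2) disj] by simp
  moreover have "card (face i S \<union> face j S) \<le> 4"
    using card_mono[OF fin, of "face i S \<union> face j S"] sub four by simp
  ultimately have card2: "card (face i S) = 2" "card (face j S) = 2"
    and "card (face i S \<union> face j S) = card S"
    using ge four by linarith+
  then have S: "S = face i S \<union> face j S"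
    using card_subset_eq[OF fin, of "face i S \<union> face j S"] sub by simp
  have "card (face k S) \<le> card (face k S \<inter> face i S) + card (face j S \<inter> face k S)"
    using card_Un_le[of "face k S \<inter> face i S" "face j S \<inter> face k S"] S sub(3)
    by (metis Int_Un_distrib Int_absorb2 Int_commute)
  moreover have le1: "card (face k S \<inter> face i S) \<le> 1" "card (face j S \<inter> face k S) \<le> 1"
    using card_faces_Int[OF rel'(2), of m] card_faces_Int[OF rel'(1), of m] hom
    by (simp_all add: ac_simps)
  ultimately have one: "card (face k S \<inter> face i S) = 1" "card (face j S \<inter> face k S) = 1"
    and k2: "card (face k S) = 2"
    using ge(3) by linarith+
  obtain B where B: "face k S \<inter> face i S = {B}" using one by (meson card_1_singletonE)
  obtain A where A: "face j S \<inter> face k S = {A}" using one by (meson card_1_singletonE)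
  have "A \<noteq> B" using A B disj by auto
  have K: "face k S = {A, B}" using A B S sub(3) by blast
  obtain X where X: "face i S = {B, X}" "X \<noteq> B"
    using card2(1) B by (metis Int_iff card_2_iff insert_commute insertE singletonD singletonI)
  obtain Y where Y: "face j S = {A, Y}" "Y \<noteq> A"
    using card2(2) A by (metis Int_iff card_2_iff insert_commute insertE singletonD singletonI)
  have dist: "X \<noteq> A" "X \<noteq> Y" "Y \<noteq> B" using disj X Y by auto
  have Seq: "S = {A, B, X, Y}" using S X Y by auto
  have dAB: "d A = d B" using face_pair[OF rel K \<open>A \<noteq> B\<close>] by simp
  have dX: "d B = d X" "even (k B) \<longleftrightarrow> odd (k X)"
    using face_pair[OF rel'(1) X(1)] X(2) by auto
  have dY: "d A = d Y" "even (k A) \<longleftrightarrow> odd (k Y)"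
    using face_pair[OF plane_relation_swap[OF rel'(2)] Y(1)] Y(2) by auto
  have kA: "k A \<le> k b" if "b \<in> S" for b using K that by (auto simp: face_def)
  have kB: "k B = k A" using K by (auto simp: face_def intro: antisym)
  have odd: "odd (k X - k A)" "odd (k Y - k A)"
    using dX dY kA[of X] kA[of Y] kB Seq by auto
  have "d A > 0" using rel Seq by (auto simp: plane_relation_def)
  have "(\<Sum>b\<in>S. d b * (-2) ^ (k b - k A)) = 0"
    by (rule relation_at_1_1_minus_2[OF rel kA])
  then have "d A * (2 - 2 ^ (k X - k A) - 2 ^ (k Y - k A)) = 0"
    using dist X(2) Y(2) \<open>A \<noteq> B\<close> odd dX dY dAB kB
    by (simp add: Seq algebra_simps)
  then have "2 - 2 ^ (k X - k A) - 2 ^ (k Y - k A) = (0::real)" using \<open>d A > 0\<close> by simp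
  moreover have "(2::real) ^ (k X - k A) \<ge> 2 ^ 1" "(2::real) ^ (k Y - k A) \<ge> 2 ^ 1"
    using odd[THEN odd_pos] by (intro power_increasing; linarith)+
  ultimately show False by simp
qed

text \<open>Here \<open>A\<close>, \<open>B\<close>, \<open>C\<close> are the corners of a triangle of side
  length \<open>M\<close>, that is, the terms \<open>x\<^sup>M\<close>, \<open>y\<^sup>M\<close>,
  \<open>z\<^sup>M\<close> up to a common factor. At \<open>(1, 1, - 2)\<close> they contribute a multiple
  of \<open>2 - 2\<^sup>M\<close>, which is negative for \<open>M \<ge> 2\<close>, so the fourth term has to
  contribute a positive number.\<close>

lemma even_exponent_of_fourth_term:
  assumes rel: "plane_relation S d i j k"
    and S: "S = {A, B, C, X}" "distinct [A, B, C, X]"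
    and eq: "d A = d C" "d B = d C"
    and k: "k A = k0" "k B = k0" "k C = k0 + M" "k0 \<le> k X" and M: "odd M" "M \<ge> 2"
  shows "even (k X - k0)"
proof (rule ccontr)
  assume odd: "odd (k X - k0)"
  have pos: "d C > 0" "d X > 0" using rel S by (auto simp: plane_relation_def)
  have "(\<Sum>b\<in>S. d b * (-2) ^ (k b - k0)) = 0"
    by (rule relation_at_1_1_minus_2[OF rel]) (use S k in auto)
  then have "d C * (2 - 2 ^ M) = d X * 2 ^ (k X - k0)"
    using S eq k M odd by (simp add: algebra_simps)
  moreover have "d X * 2 ^ (k X - k0) > 0" using pos by simp
  moreover have "(2::real) ^ M \<ge> 2 ^ 2" using M by (intro power_increasing) auto
  then have "d C * (2 - 2 ^ M) < 0" using pos by (simp add: mult_less_0_iff)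
  ultimately show False by simp
qed

text \<open>With all three corners present, the remaining term \<open>X\<close> lies on at most one side.
  The other two sides are pairs, so the corners have equal coefficients and the side length \<open>M\<close>
  is odd. The exponents of \<open>X\<close>, measured from the sides, add up to \<open>M\<close>. This
  excludes \<open>M = 1\<close>, and for larger \<open>M\<close> all three of them are even by
  \<open>even_exponent_of_fourth_term\<close>, while \<open>M\<close> is odd.\<close>

lemma no_four_terms_triangle:
  assumes rel: "plane_relation S d i j k" and hom: "\<And>b. b \<in> S \<Longrightarrow> i b + j b + k b = m"
    and four: "card S = 4"
    and C: "C \<in> face i S" "C \<in> face j S"
    and A: "A \<in> face j S" "A \<in> face k S"
    and B: "B \<in> face k S" "B \<in> face i S"
  shows False
proof -
  note rel' = plane_relation_rotate[OF rel] plane_relation_rotate[OF plane_relation_rotate[OF rel]]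
  have inS: "A \<in> S" "B \<in> S" "C \<in> S" using A B C by (auto simp: face_def)
  have fin: "finite S" and "S \<noteq> {}" using four by (auto intro: card_ge_0_finite)
  have meet: "b = c" if "b \<in> face i S" "b \<in> face j S" "c \<in> face i S" "c \<in> face j S" for b c
    using faces_meet_once[OF rel hom] that by blast
  have meet': "b = c" if "b \<in> face j S" "b \<in> face k S" "c \<in> face j S" "c \<in> face k S" for b c
    using faces_meet_once[OF rel'(1), of m] hom that by (simp add: ac_simps)
  have meet'': "b = c" if "b \<in> face k S" "b \<in> face i S" "c \<in> face k S" "c \<in> face i S" for b c
    using faces_meet_once[OF rel'(2), of m] hom that by (simp add: ac_simps)
  \<comment> \<open>the side length of the triangle\<close>
  define M where "M = k C - k A"
  have kC: "k C = k A + M" and kB: "k B = k A" and iC: "i C = i B" and jC: "j C = j A"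
    using A B C unfolding M_def face_def by (auto intro: antisym)
  have iA: "i A = i B + M" and jB: "j B = j A + M"
    using hom[OF inS(1)] hom[OF inS(2)] hom[OF inS(3)] kC kB iC jC by linarith+
  have low: "i B \<le> i b" "j A \<le> j b" "k A \<le> k b" if "b \<in> S" for b
    using A B that by (auto simp: face_def)
  have "M \<noteq> 0"
  proof
    assume "M = 0"
    then have "b = A" if "b \<in> S" for b
    proof -
      have "i b = i A" "j b = j A" "k b = k A"
        using low[OF that] hom[OF that] hom[OF inS(1)] iA \<open>M = 0\<close> by linarith+
      then show ?thesis using rel that inS(1) by (auto simp: plane_relation_def)
    qed
    then have "card S \<le> card {A}" by (intro card_mono) auto
    then show False using four by simp
  qed
  then have dist: "A \<noteq> B" "A \<noteq> C" "B \<noteq> C" using iA kB kC iC by auto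
  have "card (S - {A, B, C}) = 1"
    using four dist inS fin by (subst card_Diff_subset) auto
  then obtain X where X: "S - {A, B, C} = {X}" by (meson card_1_singletonE)
  then have Seq: "S = {A, B, C, X}" and XS: "X \<in> S" and dX: "X \<noteq> A" "X \<noteq> B" "X \<noteq> C"
    using inS by blast+
  have notA: "A \<notin> face i S" using meet[OF C, of A] A dist by blast
  have notB: "B \<notin> face j S" using meet[OF C, of B] B dist by blast
  have notC: "C \<notin> face k S" using meet''[OF B, of C] C dist by blast
  have sub: "face i S \<subseteq> S" "face j S \<subseteq> S" "face k S \<subseteq> S"
    by (auto simp: face_def)
  have I: "d B = d C \<and> odd M" if "X \<notin> face i S"
  proof -
    have "face i S = {C, B}" using that Seq sub(1) notA B C by blast
    from face_pair[OF rel'(1) this] show ?thesis using dist kB kC by auto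
  qed
  have J: "d A = d C \<and> odd M" if "X \<notin> face j S"
  proof -
    have "face j S = {A, C}" using that Seq sub(2) notB A C by blast
    from face_pair[OF rel'(2) this] show ?thesis using dist iC iA by auto
  qed
  have K: "d A = d B \<and> odd M" if "X \<notin> face k S"
  proof -
    have "face k S = {A, B}" using that Seq sub(3) notC A B by blast
    from face_pair[OF rel this] show ?thesis using dist jB by auto
  qed
  have "\<not> (X \<in> face i S \<and> X \<in> face j S)" "\<not> (X \<in> face j S \<and> X \<in> face k S)"
      "\<not> (X \<in> face k S \<and> X \<in> face i S)"
    using meet[OF C, of X] meet'[OF A, of X] meet''[OF B, of X] dX by blast+
  then have eq: "d A = d C" "d B = d C" and "odd M"
    using I J K by argo+
  have sumX: "(i X - i B) + (j X - j A) + (k X - k A) = M"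
    using low[OF XS] hom[OF XS] hom[OF inS(1)] iA by linarith
  \<comment> \<open>a triangle of side length \<open>1\<close> contains no lattice points besides its corners\<close>
  have "M \<noteq> 1"
  proof
    assume "M = 1"
    then have "(i X = i A \<and> j X = j A \<and> k X = k A) \<or> (i X = i B \<and> j X = j B \<and> k X = k B) \<or>
        (i X = i C \<and> j X = j C \<and> k X = k C)"
      using sumX low[OF XS] iA jB kC iC jC kB
      by (cases "i X - i B"; cases "j X - j A") auto
    then show False using rel XS inS dX unfolding plane_relation_def by blast
  qed
  then have "M \<ge> 2" using \<open>M \<noteq> 0\<close> by simp
  have "even (k X - k A)"
    by (rule even_exponent_of_fourth_term[OF rel Seq _ eq])
       (use dist dX kB kC low XS \<open>odd M\<close> \<open>M \<ge> 2\<close> in auto)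
  moreover have "even (i X - i B)"
    by (rule even_exponent_of_fourth_term[OF rel'(1), of B C A X])
       (use dist dX Seq eq iC iA low XS \<open>odd M\<close> \<open>M \<ge> 2\<close> in auto)
  moreover have "even (j X - j A)"
    by (rule even_exponent_of_fourth_term[OF rel'(2), of C A B X])
       (use dist dX Seq eq jC jB low XS \<open>odd M\<close> \<open>M \<ge> 2\<close> in auto)
  ultimately show False using sumX \<open>odd M\<close> by (metis even_add)
qed

lemma homogeneous_term_count:
  assumes rel: "plane_relation S d i j k" and hom: "\<And>b. b \<in> S \<Longrightarrow> i b + j b + k b = m"
    and "S \<noteq> {}"
  shows "card S \<ge> 3" "card S \<noteq> 4"
proof -
  note rel' = plane_relation_rotate[OF rel] plane_relation_rotate[OF plane_relation_rotate[OF rel]]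
  have hom': "j b + k b + i b = m" "k b + i b + j b = m" if "b \<in> S" for b
    using hom[OF that] by simp_all
  have fin: "finite S" using rel by (simp add: plane_relation_def)
  have "card (face i S) + card (face j S) = card (face i S \<union> face j S) + card (face i S \<inter> face j S)"
    by (rule card_Un_Int) (use fin in \<open>auto simp: face_def\<close>)
  moreover have "card (face i S \<union> face j S) \<le> card S"
    using fin by (intro card_mono) (auto simp: face_def)
  moreover have "card (face i S \<inter> face j S) \<le> 1" using card_faces_Int[OF rel hom] .
  moreover have "card (face i S) \<ge> 2" "card (face j S) \<ge> 2"
    using card_face \<open>S \<noteq> {}\<close> rel' by metis+
  ultimately show "card S \<ge> 3" by linarith
  show "card S \<noteq> 4"
  proof
    assume four: "card S = 4"
    have "face i S \<inter> face j S \<noteq> {}" "face j S \<inter> face k S \<noteq> {}" "face k S \<inter> face i S \<noteq> {}"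
      using no_four_terms_disjoint_faces[OF rel hom four]
        no_four_terms_disjoint_faces[OF rel'(1) hom'(1) four]
        no_four_terms_disjoint_faces[OF rel'(2) hom'(2) four] by blast+
    then show False using no_four_terms_triangle[OF rel hom four] by blast
  qed
qed

text \<open>Every nonzero homogeneous part has three or at least five terms, and two such parts together
  have at least six.\<close>

lemma plane_relation_term_count:
  assumes rel: "plane_relation S d i j k"
  shows "card S = 0 \<or> card S = 3 \<or> card S \<ge> 5"
proof (cases "S = {}")
  case False
  define T where "T m = {b \<in> S. i b + j b + k b = m}" for m
  have T: "plane_relation (T m) d i j k" for m
    unfolding T_def by (rule plane_relation_homogeneous_part[OF rel])
  have fin: "finite S" using rel by (simp add: plane_relation_def)
  have ge3: "card (T m) \<ge> 3" if "T m \<noteq> {}" for m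
    using homogeneous_term_count(1)[OF T _ that] by (simp add: T_def)
  have ne4: "card (T m) \<noteq> 4" if "T m \<noteq> {}" for m
    using homogeneous_term_count(2)[OF T _ that] by (simp add: T_def)
  obtain b where "b \<in> S" using False by auto
  define m where "m = i b + j b + k b"
  have "T m \<noteq> {}" using \<open>b \<in> S\<close> by (auto simp: T_def m_def)
  show ?thesis
  proof (cases "S = T m")
    case True
    then show ?thesis using ge3[OF \<open>T m \<noteq> {}\<close>] ne4[OF \<open>T m \<noteq> {}\<close>] by auto
  next
    case False
    then obtain c where "c \<in> S" "c \<notin> T m" by (auto simp: T_def)
    define l where "l = i c + j c + k c"
    have "T l \<noteq> {}" "T m \<inter> T l = {}" using \<open>c \<in> S\<close> \<open>c \<notin> T m\<close> by (auto simp: T_def l_def)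
    then have "card (T m) + card (T l) = card (T m \<union> T l)"
      using fin by (subst card_Un_disjoint) (auto simp: T_def)
    also have "\<dots> \<le> card S" using fin by (intro card_mono) (auto simp: T_def)
    finally show ?thesis using ge3[OF \<open>T m \<noteq> {}\<close>] ge3[OF \<open>T l \<noteq> {}\<close>] by simp
  qed
qed simp

section \<open>Coefficient matrices\<close>

text \<open>The polynomial with \<open>cnj z\<close> replaced by an independent variable \<open>w\<close>.
  Two substitutions are of interest: \<open>w = cnj z\<close> gives back the real polynomial, and \<open>w =
  (1, \<dots>, 1)\<close> turns a diagonal matrix into the polynomial whose coefficients are its diagonal
  entries.\<close>

definition polarization ::
    "(((nat ^ 'n) \<times> (nat ^ 'n)) \<Rightarrow>\<^sub>0 complex) \<Rightarrow> complex ^ 'n \<Rightarrow> complex ^ 'n \<Rightarrow> complex" where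
  "polarization c z w =
     (\<Sum>(a, b)\<in>Poly_Mapping.keys c. Poly_Mapping.lookup c (a, b) * monom_at z a * monom_at w b)"

lemma cnj_monom_at: "cnj (monom_at z a) = monom_at (\<chi> i. cnj (z $ i)) a"
  by (simp add: monom_at_def)

lemma diag_eval_eq_polarization: "diag_eval c z = polarization c z (\<chi> i. cnj (z $ i))"
  by (simp add: diag_eval_def polarization_def cnj_monom_at)

lemma polarization_eq_sum:
  assumes "finite S" "Poly_Mapping.keys c \<subseteq> S"
  shows "polarization c z w =
     (\<Sum>(a, b)\<in>S. Poly_Mapping.lookup c (a, b) * monom_at z a * monom_at w b)"
  unfolding polarization_def using assms
  by (intro sum.mono_neutral_left) (auto simp: in_keys_iff)

lemma polarization_0 [simp]: "polarization 0 z w = 0"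
  by (simp add: polarization_def)

lemma polarization_add: "polarization (c + d) z w = polarization c z w + polarization d z w"
  using polarization_eq_sum[of "Poly_Mapping.keys c \<union> Poly_Mapping.keys d" c z w]
    polarization_eq_sum[of "Poly_Mapping.keys c \<union> Poly_Mapping.keys d" d z w]
    polarization_eq_sum[of "Poly_Mapping.keys c \<union> Poly_Mapping.keys d" "c + d" z w]
    Poly_Mapping.keys_add[of c d]
  by (simp add: lookup_add algebra_simps sum.distrib case_prod_unfold)

lemma polarization_sum: "polarization (\<Sum>s\<in>S. f s) z w = (\<Sum>s\<in>S. polarization (f s) z w)"
  by (induction S rule: infinite_finite_induct) (simp_all add: polarization_add)

lemma polarization_single [simp]:
  "polarization (Poly_Mapping.single (a, b) v) z w = v * monom_at z a * monom_at w b"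
  by (simp add: polarization_def)

lemma monom_at_add_axis: "monom_at z (a + axis i 1) = monom_at z a * z $ i"
proof -
  have "monom_at z (a + axis i 1) = monom_at z a * (\<Prod>j\<in>UNIV. z $ j ^ (axis i 1 $ j))"
    by (simp add: monom_at_def power_add prod.distrib)
  also have "(\<Prod>j\<in>UNIV. z $ j ^ (axis i 1 $ j)) = (\<Prod>j\<in>UNIV. if j = i then z $ j else 1)"
    by (intro prod.cong) (auto simp: axis_def)
  finally show ?thesis by simp
qed

text \<open>The coefficient matrix of the product with \<open>(norm z)\<^sup>2\<close>, see
  \<open>diag_eval_times_norm_sq\<close>.\<close>

definition times_norm_sq ::
    "(((nat ^ 'n) \<times> (nat ^ 'n)) \<Rightarrow>\<^sub>0 complex) \<Rightarrow> (((nat ^ 'n) \<times> (nat ^ 'n)) \<Rightarrow>\<^sub>0 complex)" where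
  "times_norm_sq c = (\<Sum>(a, b)\<in>Poly_Mapping.keys c. \<Sum>i\<in>UNIV.
     Poly_Mapping.single (a + axis i 1, b + axis i 1) (Poly_Mapping.lookup c (a, b)))"

lemma polarization_times_norm_sq:
  "polarization (times_norm_sq c) z w = polarization c z w * (\<Sum>i\<in>UNIV. z $ i * w $ i)"
proof -
  have "polarization (times_norm_sq c) z w = (\<Sum>(a, b)\<in>Poly_Mapping.keys c. \<Sum>i\<in>UNIV.
      (Poly_Mapping.lookup c (a, b) * monom_at z a * monom_at w b) * (z $ i * w $ i))"
    by (simp add: times_norm_sq_def polarization_sum case_prod_unfold monom_at_add_axis mult_ac
        del: One_nat_def)
  then show ?thesis
    by (simp only: polarization_def sum_product case_prod_unfold)
qed

lemma times_norm_sq_diagonal: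
  assumes "matrix_is_diagonal c"
  shows "matrix_is_diagonal (times_norm_sq c)"
  unfolding matrix_is_diagonal_def times_norm_sq_def
proof (intro allI impI)
  fix a b :: "nat ^ 'a" assume "a \<noteq> b"
  have "s = t" if "(s, t) \<in> Poly_Mapping.keys c" for s t
    using assms that by (auto simp: matrix_is_diagonal_def in_keys_iff)
  with \<open>a \<noteq> b\<close> show "Poly_Mapping.lookup (\<Sum>(a, b)\<in>Poly_Mapping.keys c. \<Sum>i\<in>UNIV.
     Poly_Mapping.single (a + axis i 1, b + axis i 1) (Poly_Mapping.lookup c (a, b))) (a, b) = 0"
    by (auto simp: lookup_sum lookup_single when_def intro!: sum.neutral)
qed

lemma polarization_diagonal:
  assumes "matrix_is_diagonal c"
  shows "polarization c z (\<chi> i. 1) =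
     (\<Sum>a | Poly_Mapping.lookup c (a, a) \<noteq> 0. Poly_Mapping.lookup c (a, a) * monom_at z a)"
proof -
  have "Poly_Mapping.keys c = (\<lambda>a. (a, a)) ` {a. Poly_Mapping.lookup c (a, a) \<noteq> 0}"
  proof (intro equalityI subsetI)
    fix s assume "s \<in> Poly_Mapping.keys c"
    then obtain a b where s: "s = (a, b)" and "Poly_Mapping.lookup c (a, b) \<noteq> 0"
      by (metis in_keys_iff surj_pair)
    with assms have "b = a" unfolding matrix_is_diagonal_def by metis
    with s \<open>Poly_Mapping.lookup c (a, b) \<noteq> 0\<close>
    show "s \<in> (\<lambda>a. (a, a)) ` {a. Poly_Mapping.lookup c (a, a) \<noteq> 0}" by blast
  qed (auto simp: in_keys_iff)
  then show ?thesis
    by (simp add: polarization_def sum.reindex inj_on_def monom_at_def[of "\<chi> i. 1"])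
qed

lemma finite_diagonal_support: "finite {a. Poly_Mapping.lookup c (a, a) \<noteq> 0}"
  by (rule finite_subset[of _ "fst ` Poly_Mapping.keys c"]) (force simp: in_keys_iff image_iff)+

lemma norm_sq_eq_sum:
  fixes z :: "complex ^ 'n"
  shows "complex_of_real ((norm z)\<^sup>2) = (\<Sum>i\<in>UNIV. z $ i * cnj (z $ i))"
  by (simp add: norm_vec_def L2_set_def sum_nonneg complex_norm_square[symmetric])

lemma diag_eval_times_norm_sq:
  "diag_eval (times_norm_sq c) z = diag_eval c z * complex_of_real ((norm z)\<^sup>2)"
  by (simp add: diag_eval_eq_polarization polarization_times_norm_sq norm_sq_eq_sum
      del: of_real_power)

text \<open>The coefficient matrix of \<open>(norm (h z))\<^sup>2\<close> if the components of
  \<open>h\<close> have the coefficients \<open>p j\<close>, see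
  \<open>diag_eval_gram_matrix\<close>.\<close>

definition gram_matrix ::
    "('m::finite \<Rightarrow> ((nat ^ 'n) \<Rightarrow>\<^sub>0 complex)) \<Rightarrow> (((nat ^ 'n) \<times> (nat ^ 'n)) \<Rightarrow>\<^sub>0 complex)" where
  "gram_matrix p = (\<Sum>j\<in>UNIV. \<Sum>a\<in>Poly_Mapping.keys (p j). \<Sum>b\<in>Poly_Mapping.keys (p j).
     Poly_Mapping.single (a, b) (Poly_Mapping.lookup (p j) a * cnj (Poly_Mapping.lookup (p j) b)))"

lemma diag_eval_gram_matrix:
  fixes h :: "complex ^ 'n \<Rightarrow> complex ^ 'm"
  assumes "\<And>j z. h z $ j = (\<Sum>a\<in>Poly_Mapping.keys (p j). Poly_Mapping.lookup (p j) a * monom_at z a)"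
  shows "diag_eval (gram_matrix p) z = complex_of_real ((norm (h z))\<^sup>2)"
  unfolding norm_sq_eq_sum assms
  by (simp add: diag_eval_eq_polarization gram_matrix_def polarization_sum sum_product cnj_monom_at
      mult_ac)

text \<open>The diagonal entry at \<open>a\<close> is the sum of the squares \<open>(norm (lookup (p j)
  a))\<^sup>2\<close> over \<open>j\<close>. This is where the positivity of the coefficients in
  \<open>plane_relation\<close> comes from.\<close>

lemma lookup_gram_matrix_diagonal:
  fixes p :: "'m::finite \<Rightarrow> ((nat ^ 'n) \<Rightarrow>\<^sub>0 complex)"
  shows "\<exists>x\<ge>0. Poly_Mapping.lookup (gram_matrix p) (a, a) = complex_of_real x"
proof -
  have "(\<Sum>s\<in>Poly_Mapping.keys q. \<Sum>t\<in>Poly_Mapping.keys q.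
       (Poly_Mapping.lookup q s * cnj (Poly_Mapping.lookup q t) when s = a \<and> t = a))
     = complex_of_real ((norm (Poly_Mapping.lookup q a))\<^sup>2)" for q :: "(nat ^ 'n) \<Rightarrow>\<^sub>0 complex"
  proof -
    have "(\<Sum>t\<in>Poly_Mapping.keys q. (Poly_Mapping.lookup q s * cnj (Poly_Mapping.lookup q t) when s = a \<and> t = a))
        = (if s = a then Poly_Mapping.lookup q a * cnj (Poly_Mapping.lookup q a) else 0)" for s
      by (auto simp: when_def in_keys_iff sum.delta)
    then show ?thesis
      by (simp add: in_keys_iff sum.delta flip: complex_norm_square)
  qed
  then have "Poly_Mapping.lookup (gram_matrix p) (a, a) =
      complex_of_real (\<Sum>j\<in>UNIV. (norm (Poly_Mapping.lookup (p j) a))\<^sup>2)"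
    by (simp add: gram_matrix_def lookup_sum lookup_single)
  then show ?thesis by (intro exI[of _ "\<Sum>j\<in>UNIV. (norm (Poly_Mapping.lookup (p j) a))\<^sup>2"]) (simp add: sum_nonneg)
qed

text \<open>The nonzero rows are multiples of different unit vectors.\<close>

lemma matrix_rank_diagonal:
  assumes diag: "matrix_is_diagonal c"
  shows "matrix_rank c = card {a. Poly_Mapping.lookup c (a, a) \<noteq> 0}"
proof -
  interpret V: vector_space "\<lambda>(s :: complex) (f :: 'a \<Rightarrow> complex) x. s * f x"
    by (rule vector_space_complex_fun)
  define S where "S = {a. Poly_Mapping.lookup c (a, a) \<noteq> 0}"
  define row where "row a = (\<lambda>b. Poly_Mapping.lookup c (a, b))" for a
  have row: "row a b = (if a = b then Poly_Mapping.lookup c (a, a) else 0)" for a b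
    using diag by (auto simp: row_def matrix_is_diagonal_def)
  have inj: "inj_on row S"
    by (rule inj_onI) (metis (mono_tags, lifting) S_def mem_Collect_eq row)
  have sum_apply: "sum f A x = (\<Sum>v\<in>A. f v x)" for f :: "('a \<Rightarrow> complex) \<Rightarrow> 'a \<Rightarrow> complex" and A x
    by (induction A rule: infinite_finite_induct) (auto simp: zero_fun_def plus_fun_def)
  have indep: "V.independent (row ` S)"
  proof (subst V.independent_explicit_finite_subsets, intro allI impI ballI)
    fix T u v
    assume T: "T \<subseteq> row ` S" "finite T" "(\<Sum>v\<in>T. (\<lambda>x. u v * v x)) = 0" and v: "v \<in> T"
    obtain a where a: "a \<in> S" "v = row a" using T v by auto
    have "0 = (\<Sum>v\<in>T. u v * v a)"
      using fun_cong[OF T(3), of a] by (simp add: sum_apply)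
    also have "\<dots> = (\<Sum>w\<in>T. if w = v then u v * v a else 0)"
    proof (intro sum.cong refl)
      fix w assume "w \<in> T"
      then obtain b where "b \<in> S" "w = row b" using T by auto
      then show "u w * w a = (if w = v then u v * v a else 0)"
        using a row inj by (auto simp: inj_on_def)
    qed
    also have "\<dots> = u v * v a" using T v by simp
    finally show "u v = 0" using a by (simp add: row S_def)
  qed
  have "range row \<subseteq> V.span (row ` S)"
  proof
    fix f assume "f \<in> range row"
    then obtain a where f: "f = row a" by auto
    show "f \<in> V.span (row ` S)"
    proof (cases "a \<in> S")
      case False
      then have "f = 0" by (auto simp: f row S_def fun_eq_iff)
      then show ?thesis by (simp add: V.span_zero)
    qed (simp add: f V.span_base)
  qed
  then have "V.dim (range row) = card (row ` S)"
    by (intro V.dim_unique[of "row ` S"]) (use indep in auto)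
  then show ?thesis
    using card_image[OF inj] unfolding matrix_rank_def row_def S_def by simp
qed

section \<open>Rank and number of terms\<close>

lemma Max_triangular_less_2: "Max {k :: nat. real k * (real k + 1) / 2 < 2} = 1"
proof -
  have "k \<le> 1" if "real k * (real k + 1) / 2 < 2" for k :: nat
  proof (rule ccontr)
    assume "\<not> k \<le> 1"
    then have "2 * 3 \<le> real k * (real k + 1)" by (intro mult_mono) auto
    with that show False by simp
  qed
  then have "{k :: nat. real k * (real k + 1) / 2 < 2} = {0, 1}"
    by (auto simp: le_Suc_eq)
  then show ?thesis by simp
qed

lemma prod_UNIV_3: "prod f (UNIV :: 3 set) = f 1 * f 2 * f 3"
  unfolding UNIV_3 by (simp add: ac_simps)

text \<open>Substituting \<open>w = (1, 1, 1)\<close> turns \<open>(norm z)\<^sup>2\<close> into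
  \<open>z\<^sub>1 + z\<^sub>2 + z\<^sub>3\<close>.\<close>

lemma plane_relation_times_norm_sq:
  fixes c :: "((nat ^ 3) \<times> (nat ^ 3)) \<Rightarrow>\<^sub>0 complex"
  assumes diag: "matrix_is_diagonal c"
    and nonneg: "\<And>a. \<exists>t\<ge>0. Poly_Mapping.lookup (times_norm_sq c) (a, a) = complex_of_real t"
  shows "plane_relation {a. Poly_Mapping.lookup (times_norm_sq c) (a, a) \<noteq> 0}
     (\<lambda>a. Re (Poly_Mapping.lookup (times_norm_sq c) (a, a))) (\<lambda>a. a $ 1) (\<lambda>a. a $ 2) (\<lambda>a. a $ 3)"
    (is "plane_relation ?S ?d _ _ _")
  unfolding plane_relation_def
proof (intro conjI ballI allI impI)
  show "finite ?S" by (rule finite_diagonal_support)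
  have real: "Poly_Mapping.lookup (times_norm_sq c) (a, a) = complex_of_real (?d a)" for a
    using nonneg[of a] by auto
  show "?d a > 0" if "a \<in> ?S" for a
    using nonneg[of a] that by (auto simp: less_le)
  show "a = b" if "a $ 1 = b $ 1 \<and> a $ 2 = b $ 2 \<and> a $ 3 = b $ 3" for a b :: "nat ^ 3"
    using that by (simp add: vec_eq_iff forall_3)
  fix x y z :: real assume "x + y + z = 0"
  define v :: "complex ^ 3" where
    "v = vector [complex_of_real x, complex_of_real y, complex_of_real z]"
  have "(\<Sum>i\<in>UNIV. v $ i * (\<chi> i. 1) $ i) = complex_of_real (x + y + z)"
    by (simp add: v_def sum_3)
  then have "polarization (times_norm_sq c) v (\<chi> i. 1) = 0"
    using \<open>x + y + z = 0\<close> by (simp add: polarization_times_norm_sq)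
  then have "(\<Sum>a\<in>?S. Poly_Mapping.lookup (times_norm_sq c) (a, a) * monom_at v a) = 0"
    by (simp add: polarization_diagonal[OF times_norm_sq_diagonal[OF diag]])
  moreover have "monom_at v a = complex_of_real (x ^ (a $ 1) * y ^ (a $ 2) * z ^ (a $ 3))" for a
    unfolding monom_at_def prod_UNIV_3 by (simp add: v_def)
  ultimately have "(\<Sum>a\<in>?S. complex_of_real (?d a) *
      complex_of_real (x ^ (a $ 1) * y ^ (a $ 2) * z ^ (a $ 3))) = 0"
    by (simp only: real[symmetric])
  then have "complex_of_real (\<Sum>a\<in>?S. ?d a * (x ^ (a $ 1) * y ^ (a $ 2) * z ^ (a $ 3))) = 0"
    by (simp only: of_real_sum of_real_mult)
  then show "(\<Sum>a\<in>?S. ?d a * x ^ (a $ 1) * y ^ (a $ 2) * z ^ (a $ 3)) = 0"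
    by (simp only: of_real_eq_0_iff mult.assoc)
qed

lemma rank_of_diagonal_multiple:
  fixes r :: "complex ^ 3 \<Rightarrow> real" and h :: "complex ^ 3 \<Rightarrow> complex ^ 'm"
  assumes "real_polynomial r" and diag: "matrix_is_diagonal (coeff_matrix r)"
    and "holomorphic_polynomial_mapping h"
    and eq: "\<And>z. r z * (norm z)\<^sup>2 = (norm (h z))\<^sup>2"
  defines "\<rho> \<equiv> real_polynomial_rank (\<lambda>z. (norm (h z))\<^sup>2)"
  shows "\<rho> = 0 \<or> \<rho> = 3 \<or> \<rho> \<ge> 5"
proof -
  obtain c where c: "\<And>z. complex_of_real (r z) = diag_eval c z"
    using assms(1) unfolding real_polynomial_def by blast
  then have "coeff_matrix r = c" by (rule coeff_matrix_eqI)
  with diag have diag_c: "matrix_is_diagonal c" by simp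
  obtain p where p: "\<And>j z. h z $ j =
      (\<Sum>a\<in>Poly_Mapping.keys (p j). Poly_Mapping.lookup (p j) a * monom_at z a)"
    using assms(3) unfolding holomorphic_polynomial_mapping_def holomorphic_polynomial_def
    by metis
  have gram: "complex_of_real ((norm (h z))\<^sup>2) = diag_eval (gram_matrix p) z" for z
    using diag_eval_gram_matrix[of h p, OF p] by simp
  have "diag_eval (times_norm_sq c) z = diag_eval (gram_matrix p) z" for z
    by (simp only: diag_eval_times_norm_sq c[symmetric] gram[symmetric] eq[symmetric] of_real_mult)
  then have times_eq: "times_norm_sq c = gram_matrix p" by (rule diag_eval_inj)
  have "coeff_matrix (\<lambda>z. (norm (h z))\<^sup>2) = times_norm_sq c"
    unfolding times_eq by (rule coeff_matrix_eqI) (rule gram)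
  then have "\<rho> = card {a. Poly_Mapping.lookup (times_norm_sq c) (a, a) \<noteq> 0}"
    by (simp add: \<rho>_def real_polynomial_rank_def
        matrix_rank_diagonal[OF times_norm_sq_diagonal[OF diag_c]])
  moreover have "\<exists>t\<ge>0. Poly_Mapping.lookup (times_norm_sq c) (a, a) = complex_of_real t" for a
    unfolding times_eq by (rule lookup_gram_matrix_diagonal)
  ultimately show ?thesis
    using plane_relation_term_count[OF plane_relation_times_norm_sq[OF diag_c]] by simp
qed

theorem theorem1:
  fixes n k0 \<rho> :: nat
    and r :: "complex ^ 3 \<Rightarrow> real"
    and h :: "complex ^ 3 \<Rightarrow> complex ^ 'm"
  assumes "n = 3"
    and "k0 = Max {k :: nat. real k * (real k + 1) / 2 < real n - 1}"
    and "real_polynomial r"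
    and "matrix_is_diagonal (coeff_matrix r)"
    and "holomorphic_polynomial_mapping h"
    and "\<And>z. r z * (norm z)\<^sup>2 = (norm (h z))\<^sup>2"
    and "\<rho> = real_polynomial_rank (\<lambda>z. (norm (h z))\<^sup>2)"
  shows "k0 = 1 \<and>
    (real k0 + 1) * real n - real k0 * (real k0 + 1) / 2 = 5 \<and>
    (real \<rho> \<ge> (real k0 + 1) * real n - real k0 * (real k0 + 1) / 2 \<or>
     (\<exists>k :: nat. k \<le> k0 \<and>
        real n * real k - real k * (real k - 1) / 2 \<le> real \<rho> \<and>
        real \<rho> \<le> real n * real k))"
proof -
  have "k0 = 1" using assms(1,2) Max_triangular_less_2 by simp
  consider "\<rho> = 0" | "\<rho> = 3" | "\<rho> \<ge> 5"
    using rank_of_diagonal_multiple[OF assms(3-6)] assms(7) by metis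
  then show ?thesis
  proof cases
    case 1
    then show ?thesis using \<open>n = 3\<close> \<open>k0 = 1\<close> by (auto intro!: exI[of _ 0])
  next
    case 2
    then show ?thesis using \<open>n = 3\<close> \<open>k0 = 1\<close> by (auto intro!: exI[of _ 1])
  next
    case 3
    then show ?thesis using \<open>n = 3\<close> \<open>k0 = 1\<close> by simp
  qed
qed

end
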